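(* There is a tight simplex of $12$ points in $\mathbb{H}\mathbb{P}^2$. In fact, there is such a tight simplex with cyclic symmetry, i.e., one such that whenever the point represented by $(x,y,z)\in\mathbb{H}^3$ belongs to it, so do the points represented by $(y,z,x)$ and $(z,x,y)$, and these are three distinct points of $\mathbb{H}\mathbb{P}^2$.
   Context: $\mathbb{H}\mathbb{P}^2$ is the space of quaternionic lines in $\mathbb{H}^3$ (scalars acting on the right), points represented by unit vectors, with $\langle x,y\rangle = x^\dagger y$. A tight simplex of $N$ points in $\mathbb{H}\mathbb{P}^{2}$ is a set of $N$ distinct points $x_1,\dots,x_N$ with $|\langle x_i,x_j\rangle|^2=\frac{N-3}{3(N-1)}$ for all $i\ne j$. *)

theory Defs
  imports Complex_Main
begin

text \<open>Real quaternions a + b i + c j + d k.\<close>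
datatype quat = Quat real real real real

fun qadd :: "quat \<Rightarrow> quat \<Rightarrow> quat" where
  "qadd (Quat a1 b1 c1 d1) (Quat a2 b2 c2 d2) = Quat (a1+a2) (b1+b2) (c1+c2) (d1+d2)"

text \<open>Hamilton product (i^2 = j^2 = k^2 = ijk = -1).\<close>
fun qmult :: "quat \<Rightarrow> quat \<Rightarrow> quat" where
  "qmult (Quat a1 b1 c1 d1) (Quat a2 b2 c2 d2) =
     Quat (a1*a2 - b1*b2 - c1*c2 - d1*d2)
          (a1*b2 + b1*a2 + c1*d2 - d1*c2)
          (a1*c2 - b1*d2 + c1*a2 + d1*b2)
          (a1*d2 + b1*c2 - c1*b2 + d1*a2)"

fun qcnj :: "quat \<Rightarrow> quat" where
  "qcnj (Quat a b c d) = Quat a (-b) (-c) (-d)"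

fun qnorm2 :: "quat \<Rightarrow> real" where
  "qnorm2 (Quat a b c d) = a^2 + b^2 + c^2 + d^2"

type_synonym hvec = "quat \<times> quat \<times> quat"

fun hinner :: "hvec \<Rightarrow> hvec \<Rightarrow> quat" where
  "hinner (x1, x2, x3) (y1, y2, y3) =
     qadd (qadd (qmult (qcnj x1) y1) (qmult (qcnj x2) y2)) (qmult (qcnj x3) y3)"

fun hnorm2 :: "hvec \<Rightarrow> real" where
  "hnorm2 (x1, x2, x3) = qnorm2 x1 + qnorm2 x2 + qnorm2 x3"

definition unit_hvec :: "hvec \<Rightarrow> bool" where
  "unit_hvec x \<longleftrightarrow> hnorm2 x = 1"

fun scale_right :: "hvec \<Rightarrow> quat \<Rightarrow> hvec" where
  "scale_right (x1, x2, x3) q = (qmult x1 q, qmult x2 q, qmult x3 q)"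

text \<open>Two unit vectors represent the same point of HP^2 iff they differ by a
  right unit scalar.\<close>
definition same_point :: "hvec \<Rightarrow> hvec \<Rightarrow> bool" where
  "same_point x y \<longleftrightarrow> (\<exists>q. qnorm2 q = 1 \<and> x = scale_right y q)"

definition tight_simplex :: "nat \<Rightarrow> (nat \<Rightarrow> hvec) \<Rightarrow> bool" where
  "tight_simplex N v \<longleftrightarrow>
     (\<forall>i<N. unit_hvec (v i)) \<and>
     (\<forall>i<N. \<forall>j<N. i \<noteq> j \<longrightarrow>
        \<not> same_point (v i) (v j) \<and>
        qnorm2 (hinner (v i) (v j)) = (real N - 3) / (3 * (real N - 1)))"

fun cyc :: "hvec \<Rightarrow> hvec" where
  "cyc (x, y, z) = (y, z, x)"

definition cyclic_symmetric :: "nat \<Rightarrow> (nat \<Rightarrow> hvec) \<Rightarrow> bool" where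
  "cyclic_symmetric N v \<longleftrightarrow>
     (\<forall>i<N. (\<exists>j<N. same_point (v j) (cyc (v i))) \<and>
             (\<exists>j<N. same_point (v j) (cyc (cyc (v i)))) \<and>
             \<not> same_point (v i) (cyc (v i)) \<and>
             \<not> same_point (v i) (cyc (cyc (v i))) \<and>
             \<not> same_point (cyc (v i)) (cyc (cyc (v i))))"

end

theory Submission
  imports Defs
begin

text \<open>Decompose the quaternionic 3-space under the cyclic shift: a vector is a scalar
  \<open>a\<close>, which may be taken real, together with a vector \<open>y\<close> in
  \<open>\<complex>\<^sup>4\<close> (two quaternions, the cosine and sine parts of a discrete
  Fourier transform), and the shift multiplies \<open>y\<close> by a primitive cube root of unity.
  For two such vectors the squared modulus of the inner product depends only on the scalars, the
  Hermitian product of the \<open>y\<close>, their complex square forms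
  \<open>\<Sum> (y k)\<^sup>2\<close>, their norms, and the moments in
  \<open>\<real>\<^sup>3\<close> given by the left action of \<open>SU(2)\<close>. Averaging over
  the shift separates the conditions for four orbits of three points into conditions on the Gram
  matrix of the moments and conditions on the Hermitian products. Writing
  \<open>t i = (a i)\<^sup>2\<close>, the first group says that the moments have Gram matrix
  \<open>(16/33) I - 3 u u\<^sup>T - (4/33) J\<close> with \<open>u = t - 1/3\<close>, and so can
  be solved explicitly once \<open>\<Sum> t i = 4/3\<close>; this matters because these equations,
  as inner product equations, have a singular Jacobian. With
  \<open>t = (2/3, 2/9, 2/9, 2/9)\<close> and fixed moments, the remaining equations form a square
  nonsingular quadratic system, and a contraction argument around a numerical solution yields an
  exact one.\<close>

section \<open>Orbits of the cyclic shift\<close>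

type_synonym c4 = "complex \<times> complex \<times> complex \<times> complex"

fun csmult :: "complex \<Rightarrow> c4 \<Rightarrow> c4" where
  "csmult c (y0, y1, y2, y3) = (c * y0, c * y1, c * y2, c * y3)"

fun herm :: "c4 \<Rightarrow> c4 \<Rightarrow> complex" where
  "herm (y0, y1, y2, y3) (z0, z1, z2, z3) = cnj y0 * z0 + cnj y1 * z1 + cnj y2 * z2 + cnj y3 * z3"

text \<open>Complex bilinear, not Hermitian. If \<open>P\<close> and \<open>Q\<close> are the
  quaternions formed by the real and the imaginary parts, its value is
  \<open>|P|^2 - |Q|^2 + 2 i <P, Q>\<close>.\<close>

fun sqform :: "c4 \<Rightarrow> complex" where
  "sqform (y0, y1, y2, y3) = y0\<^sup>2 + y1\<^sup>2 + y2\<^sup>2 + y3\<^sup>2"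

text \<open>With the same \<open>P\<close> and \<open>Q\<close>, twice the vector part of
  \<open>Q\<close> times the conjugate of \<open>P\<close>; a common unit factor on the right of
  both cancels.\<close>

fun moment :: "c4 \<Rightarrow> real \<times> real \<times> real" where
  "moment (y0, y1, y2, y3) =
     (2 * Im (cnj y0 * y1 + cnj y2 * y3), 2 * Im (cnj y0 * y2 + cnj y3 * y1),
      2 * Im (cnj y0 * y3 + cnj y1 * y2))"

fun dot3 :: "real \<times> real \<times> real \<Rightarrow> real \<times> real \<times> real \<Rightarrow> real" where
  "dot3 (a, b, c) (a', b', c') = a * a' + b * b' + c * c'"

text \<open>Inverse real Fourier transform on three points:
  \<open>a / sqrt 3 + sqrt (2 / 3) * (cos * P + sin * Q)\<close> at the angles 0, 2 pi / 3 and 4 pi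
  / 3, normalised to be orthogonal.\<close>

fun emb :: "real \<Rightarrow> c4 \<Rightarrow> hvec" where
  "emb a (y0, y1, y2, y3) =
    (let X = (\<lambda>c s. Quat (sqrt 3 / 3 * a + c * Re y0 + s * Im y0) (c * Re y1 + s * Im y1)
                        (c * Re y2 + s * Im y2) (c * Re y3 + s * Im y3))
     in (X (sqrt 6 / 3) 0, X (- sqrt 6 / 6) (sqrt 2 / 2), X (- sqrt 6 / 6) (- sqrt 2 / 2)))"

text \<open>The root exp(- 2 pi i / 3): advancing the angle in \<open>emb\<close> by 2 pi / 3 turns
  \<open>P + i Q\<close> clockwise.\<close>

definition cube_root_unity :: complex where
  "cube_root_unity = Complex (- 1 / 2) (- sqrt 3 / 2)"

lemma cyc_emb: "cyc (emb a y) = emb a (csmult cube_root_unity y)"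
proof -
  have *: "sqrt 6 = sqrt 2 * sqrt 3" by (simp flip: real_sqrt_mult)
  show ?thesis
    by (cases y) (simp add: cube_root_unity_def * field_simps)
qed

text \<open>Parseval: the transform is a real orthogonal matrix, so quaternionic inner products are
  sums over the three Fourier coefficients.\<close>

lemma hinner_emb:
  "hinner (emb a (y0, y1, y2, y3)) (emb b (z0, z1, z2, z3)) =
    qadd (Quat (a * b) 0 0 0)
     (qadd (qmult (qcnj (Quat (Re y0) (Re y1) (Re y2) (Re y3))) (Quat (Re z0) (Re z1) (Re z2) (Re z3)))
       (qmult (qcnj (Quat (Im y0) (Im y1) (Im y2) (Im y3))) (Quat (Im z0) (Im z1) (Im z2) (Im z3))))"
proof -
  have *: "sqrt 6 = sqrt 2 * sqrt 3" by (simp flip: real_sqrt_mult)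
  show ?thesis
    by (simp add: Let_def * field_simps)
qed

text \<open>Expand the square. The cross term is the real part of a product of two quaternions,
  whose scalar parts go into \<open>sqform\<close> and whose vector parts give the moments. Only the
  last summand feels phases.\<close>

lemma norm_hinner_emb:
  "qnorm2 (hinner (emb a y) (emb b z)) =
    (a * b)\<^sup>2 + (Re (herm y y) * Re (herm z z) + dot3 (moment y) (moment z)) / 2
      + Re (2 * a * b * herm y z + sqform y * cnj (sqform z) / 2)"
  by (cases y; cases z)
     (simp only: hinner_emb, simp add: power2_eq_square field_simps)

lemma herm_csmult: "herm (csmult c y) (csmult d z) = cnj c * d * herm y z"
  by (cases y; cases z) (simp add: algebra_simps)

lemma sqform_csmult: "sqform (csmult c y) = c\<^sup>2 * sqform y"
  by (cases y) (simp add: power2_eq_square algebra_simps)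

lemma csmult_csmult: "csmult c (csmult d y) = csmult (c * d) y"
  by (cases y) (simp add: mult.assoc)

lemma cnj_herm: "cnj (herm y z) = herm z y"
  by (cases y; cases z) (simp add: mult.commute)

lemma herm_self_real: "herm y y = of_real (Re (herm y y))"
  using cnj_herm[of y y] by (metis Reals_cnj_iff of_real_Re)

lemma moment_csmult:
  assumes "cmod c = 1"
  shows "moment (csmult c y) = moment y"
proof -
  have c: "cnj c * c = 1"
    using assms complex_norm_square[of c] by (simp add: mult.commute)
  have *: "cnj (c * u) * (c * v) = cnj u * v" for u v
    using arg_cong[OF c, of "\<lambda>w. w * (cnj u * v)"] by (simp add: mult_ac)
  show ?thesis
    by (cases y) (simp only: csmult.simps moment.simps *)
qed

text \<open>Multiplicativity of the norm: \<open>|P|^2 |Q|^2\<close> is the square of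
  \<open><P, Q>\<close> plus that of the vector part.\<close>

lemma norm_sqform_sq: "(cmod (sqform y))\<^sup>2 = (Re (herm y y))\<^sup>2 - dot3 (moment y) (moment y)"
  by (cases y) (simp add: cmod_power2, simp add: power2_eq_square algebra_simps)

lemma hnorm2_emb: "hnorm2 (emb a y) = a\<^sup>2 + Re (herm y y)"
proof -
  have *: "sqrt 6 = sqrt 2 * sqrt 3" by (simp flip: real_sqrt_mult)
  show ?thesis
    by (cases y) (simp add: Let_def * power2_eq_square field_simps)
qed

text \<open>Makes distinctness automatic: equal points would give 1 instead of the simplex value 3 /
  11.\<close>

lemma qnorm2_hinner_same_point:
  assumes "same_point x y" "unit_hvec y"
  shows "qnorm2 (hinner x y) = 1"
proof -
  obtain q where q: "qnorm2 q = 1" "x = scale_right y q"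
    using assms(1) by (auto simp: same_point_def)
  obtain u v w where y: "y = (u, v, w)" by (cases y)
  have "hinner x y = qmult (qcnj q) (Quat (hnorm2 y) 0 0 0)"
    unfolding q(2) y
    by (cases q; cases u; cases v; cases w) (simp add: power2_eq_square algebra_simps)
  then show ?thesis
    using q(1) assms(2) by (cases q) (simp add: unit_hvec_def)
qed

lemma cube_root_unity_power3: "cube_root_unity ^ 3 = 1"
  by (simp add: cube_root_unity_def power3_eq_cube complex_eq_iff)

lemma cnj_cube_root:
  assumes "c ^ 3 = 1"
  shows "cnj c = c\<^sup>2" "cmod c = 1"
proof -
  have "cmod c ^ 3 = 1"
    using assms by (metis norm_one norm_power)
  then show n: "cmod c = 1"
    using power_eq_imp_eq_base[of "cmod c" 3 1] by simp
  have "c * cnj c = 1"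
    using n by (simp add: complex_norm_square[symmetric])
  moreover have "c * c\<^sup>2 = 1"
    using assms by (simp add: power3_eq_cube power2_eq_square mult.assoc)
  ultimately have "c * cnj c = c * c\<^sup>2" by simp
  moreover have "c \<noteq> 0" using n by auto
  ultimately show "cnj c = c\<^sup>2" by simp
qed

lemma Re_nontrivial_cube_root:
  assumes "c ^ 3 = 1" "c \<noteq> 1"
  shows "Re c = - 1 / 2"
proof -
  have "(c - 1) * (c\<^sup>2 + c + 1) = c ^ 3 - 1"
    by (simp add: power2_eq_square power3_eq_cube algebra_simps)
  then have "cnj c + c + 1 = 0"
    using assms cnj_cube_root(1)[OF assms(1)] by auto
  then have "Re (cnj c + c + 1) = 0" by (metis zero_complex.sel(1))
  then show ?thesis by simp
qed

section \<open>Inner products inside and between orbits\<close>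

lemma unit_emb: "Re (herm y y) = 1 - a\<^sup>2 \<Longrightarrow> unit_hvec (emb a y)"
  by (simp add: unit_hvec_def hnorm2_emb)

lemma herm_csmult_self: "cmod c = 1 \<Longrightarrow> herm (csmult c y) (csmult c y) = herm y y"
  using complex_norm_square[of c] by (simp add: herm_csmult mult.commute)

text \<open>For cube roots of unity both phase terms acquire the same factor
  \<open>cnj c * d\<close>, since \<open>c\<^sup>2 = cnj c\<close>. One complex equation thus
  settles all nine pairs between two orbits.\<close>

lemma qnorm2_hinner_distinct_orbits:
  assumes c: "c ^ 3 = 1" "d ^ 3 = 1"
    and orth: "4 * of_real (a * b) * herm y z + sqform y * cnj (sqform z) = 0"
  shows "qnorm2 (hinner (emb a (csmult c y)) (emb b (csmult d z))) =
    (a * b)\<^sup>2 + (Re (herm y y) * Re (herm z z) + dot3 (moment y) (moment z)) / 2"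
proof -
  note n = cnj_cube_root[OF c(1)] cnj_cube_root[OF c(2)]
  have "2 * of_real a * of_real b * herm (csmult c y) (csmult d z)
      + sqform (csmult c y) * cnj (sqform (csmult d z)) / 2
      = cnj c * d * (4 * of_real (a * b) * herm y z + sqform y * cnj (sqform z)) / 2"
  proof -
    have "cnj (d\<^sup>2) = d" using n(3) by (metis complex_cnj_cnj)
    then show ?thesis
      by (simp add: herm_csmult sqform_csmult n(1)[symmetric] field_simps)
  qed
  also have "\<dots> = 0" using orth by simp
  finally show ?thesis
    by (simp add: norm_hinner_emb herm_csmult_self moment_csmult n)
qed

text \<open>Here the relative phase is a primitive cube root, with real part - 1 / 2, and
  \<open>norm_sqform_sq\<close> eliminates \<open>sqform\<close>. The resulting equation is linear
  in the squared length of the moment; \<open>r\<close> is its solution.\<close>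

lemma qnorm2_hinner_same_orbit:
  assumes c: "c ^ 3 = 1" "d ^ 3 = 1" "c \<noteq> d"
    and n: "Re (herm y y) = 1 - t" and r: "dot3 (moment y) (moment y) = 1 / 33 + 2 * t - 3 * t\<^sup>2"
    and t: "t = a\<^sup>2"
  shows "qnorm2 (hinner (emb a (csmult c y)) (emb a (csmult d y))) = 3 / 11"
proof -
  note nc = cnj_cube_root[OF c(1)] cnj_cube_root[OF c(2)]
  define u where "u = cnj c * d"
  have "u ^ 3 = 1"
    using c by (simp add: u_def power_mult_distrib flip: complex_cnj_power)
  moreover have "u \<noteq> 1"
  proof
    assume "u = 1"
    then have "c * (cnj c * d) = c" by (simp add: u_def)
    moreover have "c * cnj c = 1" using nc(2) by (simp add: complex_norm_square[symmetric])
    ultimately show False using c(3) by (simp flip: mult.assoc)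
  qed
  ultimately have u: "Re u = - 1 / 2" by (rule Re_nontrivial_cube_root)
  have "cnj (d\<^sup>2) = d" using nc(3) by (metis complex_cnj_cnj)
  then have "sqform (csmult c y) * cnj (sqform (csmult d y)) = u * of_real ((cmod (sqform y))\<^sup>2)"
    by (simp only: complex_norm_square) (simp add: sqform_csmult u_def nc(1)[symmetric] mult_ac)
  moreover have "herm (csmult c y) (csmult d y) = u * of_real (1 - t)"
    using herm_self_real[of y] n by (simp add: herm_csmult u_def)
  moreover have "Re (2 * of_real a * of_real a * (u * of_real (1 - t)) + u * of_real w / 2)
      = (2 * t * (1 - t) + w / 2) * Re u" for w
    by (simp add: t power2_eq_square algebra_simps)
  ultimately have "qnorm2 (hinner (emb a (csmult c y)) (emb a (csmult d y))) =
      t\<^sup>2 + ((1 - t) * (1 - t) + dot3 (moment y) (moment y)) / 2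
        + (2 * t * (1 - t) + ((1 - t)\<^sup>2 - dot3 (moment y) (moment y)) / 2) * (- 1 / 2)"
    using n u by (simp only: norm_hinner_emb norm_sqform_sq herm_csmult_self[OF nc(2)]
        herm_csmult_self[OF nc(4)] moment_csmult[OF nc(2)] moment_csmult[OF nc(4)])
      (simp add: t power2_eq_square)
  then show ?thesis
    by (simp add: r power2_eq_square field_simps)
qed

section \<open>Assembling four orbits\<close>

lemma exists_unit_cube_root: "\<exists>c. cmod c = 1 \<and> w = c ^ 3 * of_real (cmod w)"
proof -
  have "cis (Arg w / 3) ^ 3 = cis (Arg w)"
    by (simp add: DeMoivre)
  then show ?thesis
    using rcis_cmod_Arg[of w] by (intro exI[of _ "cis (Arg w / 3)"]) (simp add: rcis_def mult.commute)
qed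

text \<open>The four vectors \<open>y i\<close> may be multiplied by phases without changing their
  norms and moments. This makes it enough to prescribe the Hermitian products as negative
  reals.\<close>
lemma tight_simplex_from_orbit_representatives:
  fixes a :: "nat \<Rightarrow> real" and y :: "nat \<Rightarrow> c4"
  assumes n: "\<And>i. i < 4 \<Longrightarrow> Re (herm (y i) (y i)) = 1 - (a i)\<^sup>2"
    and mom: "\<And>i j. i < 4 \<Longrightarrow> j < 4 \<Longrightarrow> dot3 (moment (y i)) (moment (y j)) =
        (if i = j then 16 / 33 else 0) - 3 * ((a i)\<^sup>2 - 1 / 3) * ((a j)\<^sup>2 - 1 / 3) - 4 / 33"
    and prod: "\<And>i j. i < j \<Longrightarrow> j < 4 \<Longrightarrow>
        4 * of_real (a i * a j) * herm (y i) (y j) = - of_real (cmod (sqform (y i)) * cmod (sqform (y j)))"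
  shows "\<exists>v. tight_simplex 12 v \<and> cyclic_symmetric 12 v"
proof -
  have "\<exists>c. \<forall>i. cmod (c i) = 1 \<and> sqform (y i) = c i ^ 3 * of_real (cmod (sqform (y i)))"
    by (intro choice allI exists_unit_cube_root)
  then obtain c where c: "\<And>i. cmod (c i) = 1" "\<And>i. sqform (y i) = c i ^ 3 * of_real (cmod (sqform (y i)))"
    by blast
  have cc: "c i * cnj (c i) = 1" for i
    using c(1)[of i] by (simp add: complex_norm_square[symmetric])
  \<comment> \<open>This phase leaves \<open>sqform (z i)\<close> with argument that of
    \<open>c i\<close>, so both terms of the orthogonality equation carry the common factor
    \<open>c i * cnj (c j)\<close>.\<close>
  define z where "z i = csmult (cnj (c i)) (y i)" for i
  have z_herm: "herm (z i) (z i) = herm (y i) (y i)" and z_mom: "moment (z i) = moment (y i)" for i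
    using c(1)[of i] by (simp_all add: z_def herm_csmult_self moment_csmult)
  have z_sq: "sqform (z i) = c i * of_real (cmod (sqform (y i)))" for i
  proof -
    have "(cnj (c i))\<^sup>2 * c i ^ 3 = (c i * cnj (c i))\<^sup>2 * c i"
      by (simp add: power2_eq_square power3_eq_cube algebra_simps)
    then show ?thesis
      unfolding z_def sqform_csmult by (subst c(2)) (simp add: cc flip: mult.assoc)
  qed
  have lt: "4 * of_real (a i * a j) * herm (z i) (z j) + sqform (z i) * cnj (sqform (z j)) = 0"
    if "i < j" "j < 4" for i j
  proof -
    have "4 * of_real (a i * a j) * herm (z i) (z j) + sqform (z i) * cnj (sqform (z j))
      = c i * cnj (c j) * (4 * of_real (a i * a j) * herm (y i) (y j)
          + of_real (cmod (sqform (y i)) * cmod (sqform (y j))))"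
      by (simp only: z_sq) (simp add: z_def herm_csmult algebra_simps)
    then show ?thesis using prod[OF that] by simp
  qed
  have orth: "4 * of_real (a i * a j) * herm (z i) (z j) + sqform (z i) * cnj (sqform (z j)) = 0"
    if "i \<noteq> j" "i < 4" "j < 4" for i j
  proof (cases "i < j")
    case False
    then have "cnj (4 * of_real (a j * a i) * herm (z j) (z i) + sqform (z j) * cnj (sqform (z i))) = 0"
      using lt[of j i] that by simp
    then show ?thesis by (simp add: cnj_herm mult_ac)
  qed (use lt that in auto)
  define \<omega> where "\<omega> = cube_root_unity"
  \<comment> \<open>The index encodes the orbit as \<open>k div 3\<close> and the number of shifts
    as \<open>k mod 3\<close>.\<close>
  define v where "v k = emb (a (k div 3)) (csmult (\<omega> ^ (k mod 3)) (z (k div 3)))" for k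
  have w3: "\<omega> ^ 3 = 1" by (simp add: \<omega>_def cube_root_unity_power3)
  have root: "(\<omega> ^ m) ^ 3 = 1" for m
    by (metis mult.commute power_mult power_one w3)
  have w_inj: "\<omega> ^ l \<noteq> \<omega> ^ m" if "l < 3" "m < 3" "l \<noteq> m" for l m
  proof -
    have "\<omega> \<noteq> 1" "\<omega>\<^sup>2 \<noteq> 1" "\<omega> \<noteq> \<omega>\<^sup>2"
      by (auto simp: \<omega>_def cube_root_unity_def complex_eq_iff power2_eq_square)
    moreover have "l \<in> {0, 1, 2}" "m \<in> {0, 1, 2}" using that by auto
    ultimately show ?thesis using that(3) by auto
  qed
  have unit: "unit_hvec (v k)" if "k < 12" for k
    using that n[of "k div 3"] cnj_cube_root(2)[OF root]
    by (auto simp: v_def herm_csmult_self z_herm intro!: unit_emb)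
  have inner: "qnorm2 (hinner (v k) (v l)) = 3 / 11" if kl: "k < 12" "l < 12" "k \<noteq> l" for k l
  proof (cases "k div 3 = l div 3")
    case True
    have k4: "k div 3 < 4" using kl by auto
    have "dot3 (moment (y (k div 3))) (moment (y (k div 3)))
        = 1 / 33 + 2 * (a (k div 3))\<^sup>2 - 3 * ((a (k div 3))\<^sup>2)\<^sup>2"
      using mom[OF k4 k4] by (simp add: power2_eq_square algebra_simps)
    moreover have "k mod 3 \<noteq> l mod 3" using True kl(3) by (metis div_mult_mod_eq)
    ultimately show ?thesis
      unfolding v_def True[symmetric] using n[OF k4]
      by (intro qnorm2_hinner_same_orbit[where t = "(a (k div 3))\<^sup>2"] root w_inj)
         (auto simp: z_herm z_mom)
  next
    case False
    have lt4: "k div 3 < 4" "l div 3 < 4" using kl by auto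
    have "qnorm2 (hinner (v k) (v l)) =
      (a (k div 3) * a (l div 3))\<^sup>2 + ((1 - (a (k div 3))\<^sup>2) * (1 - (a (l div 3))\<^sup>2)
        + dot3 (moment (y (k div 3))) (moment (y (l div 3)))) / 2"
      unfolding v_def using qnorm2_hinner_distinct_orbits[OF root root orth[OF False lt4]] n lt4
      by (simp add: z_herm z_mom)
    then show ?thesis
      using mom[OF lt4] False by (simp add: power2_eq_square field_simps)
  qed
  have cyc_v: "\<exists>l<12. v l = cyc (v k) \<and> l \<noteq> k \<and> l div 3 = k div 3 \<and> l mod 3 = (k mod 3 + 1) mod 3" if "k < 12" for k
  proof -
    define l where "l = 3 * (k div 3) + (k mod 3 + 1) mod 3"
    have l: "l div 3 = k div 3" "l mod 3 = (k mod 3 + 1) mod 3" by (simp_all add: l_def)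
    have "\<omega> ^ ((k mod 3 + 1) mod 3) = \<omega> * \<omega> ^ (k mod 3)"
    proof (cases "k mod 3 = 2")
      case True
      then show ?thesis using w3 by (simp add: power3_eq_cube power2_eq_square mult.assoc)
    next
      case False
      then have "k mod 3 < 2" using mod_less_divisor[of 3 k] by linarith
      then show ?thesis by simp
    qed
    then have "v l = cyc (v k)"
      by (simp add: v_def l cyc_emb csmult_csmult \<omega>_def)
    moreover have "l < 12"
    proof -
      have "(k mod 3 + 1) mod 3 < 3" "k div 3 < 4" using that by auto
      then show ?thesis unfolding l_def by linarith
    qed
    moreover have "l \<noteq> k"
      using l(2) by presburger
    ultimately show ?thesis using l by blast
  qed
  have not_same: "\<not> same_point (v k) (v l)" if "k < 12" "l < 12" "k \<noteq> l" for k l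
    using qnorm2_hinner_same_point[of "v k" "v l"] unit[OF that(2)] inner[OF that] by auto
  have tight: "tight_simplex 12 v"
    unfolding tight_simplex_def using unit not_same inner by simp
  have refl: "same_point x x" for x
  proof -
    obtain p q r where x: "x = (p, q, r)" by (cases x)
    show ?thesis
      unfolding same_point_def x by (rule exI[of _ "Quat 1 0 0 0"], cases p; cases q; cases r) simp
  qed
  have "cyclic_symmetric 12 v"
    unfolding cyclic_symmetric_def
  proof (intro allI impI)
    fix k :: nat assume k: "k < 12"
    obtain l where l: "l < 12" "v l = cyc (v k)" "l \<noteq> k" "l mod 3 = (k mod 3 + 1) mod 3" using cyc_v[OF k] by blast
    obtain m where m: "m < 12" "v m = cyc (v l)" "m \<noteq> l" "m mod 3 = (l mod 3 + 1) mod 3" using cyc_v[OF l(1)] by blast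
    have "m \<noteq> k"
    proof
      assume "m = k"
      moreover have "k mod 3 = 0 \<or> k mod 3 = 1 \<or> k mod 3 = 2" by linarith
      ultimately show False using l(4) m(4) by auto
    qed
    then show "(\<exists>j<12. same_point (v j) (cyc (v k))) \<and> (\<exists>j<12. same_point (v j) (cyc (cyc (v k)))) \<and>
        \<not> same_point (v k) (cyc (v k)) \<and> \<not> same_point (v k) (cyc (cyc (v k))) \<and>
        \<not> same_point (cyc (v k)) (cyc (cyc (v k)))"
      unfolding l(2)[symmetric] m(2)[symmetric]
      using not_same[OF k l(1)] not_same[OF k m(1)] not_same[OF l(1) m(1)] l(1,3) m(1,3) refl by metis
  qed
  with tight show ?thesis by blast
qed

section \<open>Quadratic systems near an approximate solution\<close>

text \<open>Banach's fixed point argument from 0 in the maximum norm of the first \<open>n\<close>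
  coordinates, with \<open>d\<close> standing for the distance of two points.\<close>

lemma contraction_fixpoint_coordinates:
  fixes T :: "(nat \<Rightarrow> real) \<Rightarrow> nat \<Rightarrow> real"
  assumes q: "0 \<le> q" "q < 1" and r: "0 \<le> r"
    and contr: "\<And>x y d i. \<lbrakk>\<And>i. i < n \<Longrightarrow> \<bar>x i\<bar> \<le> r; \<And>i. i < n \<Longrightarrow> \<bar>y i\<bar> \<le> r;
        \<And>i. i < n \<Longrightarrow> \<bar>x i - y i\<bar> \<le> d; i < n\<rbrakk> \<Longrightarrow> \<bar>T x i - T y i\<bar> \<le> q * d"
    and start: "\<And>i. i < n \<Longrightarrow> \<bar>T (\<lambda>_. 0) i\<bar> \<le> (1 - q) * r"
  shows "\<exists>y. \<forall>i<n. \<bar>y i\<bar> \<le> r \<and> T y i = y i"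
proof -
  define s where "s k = (T ^^ k) (\<lambda>_. 0)" for k
  have s0: "s 0 = (\<lambda>_. 0)" and sS: "s (Suc k) = T (s k)" for k
    by (simp_all add: s_def)
  \<comment> \<open>Both bounds go through one induction: the contraction applies only inside the
    ball, and staying there needs the geometric sum of the earlier steps.\<close>
  have step: "(\<forall>i<n. \<bar>s k i\<bar> \<le> (1 - q ^ k) * r) \<and> (\<forall>i<n. \<bar>s (Suc k) i - s k i\<bar> \<le> q ^ k * (1 - q) * r)" for k
  proof (induction k)
    case 0
    then show ?case using start by (simp add: s0 sS)
  next
    case (Suc k)
    have b: "\<bar>s (Suc k) i\<bar> \<le> (1 - q ^ Suc k) * r" if "i < n" for i
    proof -
      have "\<bar>s (Suc k) i\<bar> \<le> (1 - q ^ k) * r + q ^ k * (1 - q) * r"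
        using Suc that by (smt (verit))
      then show ?thesis by (simp add: algebra_simps)
    qed
    have le: "(1 - q ^ m) * r \<le> r" for m
      using q r by (simp add: mult_left_le_one_le power_le_one)
    have "\<bar>T (s (Suc k)) i - T (s k) i\<bar> \<le> q * (q ^ k * (1 - q) * r)" if "i < n" for i
    proof (rule contr[OF _ _ _ that])
      show "\<bar>s (Suc k) i\<bar> \<le> r" if "i < n" for i
        using b[OF that] le[of "Suc k"] by linarith
      show "\<bar>s k i\<bar> \<le> r" if "i < n" for i
        using Suc that le[of k] by (meson order_trans)
      show "\<bar>s (Suc k) i - s k i\<bar> \<le> q ^ k * (1 - q) * r" if "i < n" for i
        using Suc that by blast
    qed
    then show ?case using b by (simp add: sS mult.assoc)
  qed
  have in_ball: "\<bar>s k i\<bar> \<le> r" if "i < n" for k i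
  proof -
    have "(1 - q ^ k) * r \<le> r"
      using q r by (simp add: mult_left_le_one_le power_le_one)
    then show ?thesis using step[of k] that by (meson order_trans)
  qed
  have far: "\<bar>s (k + m) i - s k i\<bar> \<le> q ^ k * (1 - q ^ m) * r" if "i < n" for k m i
  proof (induction m)
    case (Suc m)
    have "\<bar>s (Suc (k + m)) i - s (k + m) i\<bar> \<le> q ^ (k + m) * (1 - q) * r"
      using step[of "k + m"] that by blast
    then have "\<bar>s (k + Suc m) i - s k i\<bar> \<le> q ^ (k + m) * (1 - q) * r + q ^ k * (1 - q ^ m) * r"
      using Suc by simp
    also have "\<dots> = q ^ k * (1 - q ^ Suc m) * r"
      by (simp add: power_add algebra_simps)
    finally show ?case .
  qed simp
  have far': "\<bar>s (k + m) i - s k i\<bar> \<le> q ^ k * r" if "i < n" for k m i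
  proof -
    have "q ^ k * (1 - q ^ m) * r \<le> q ^ k * r"
      using q r by (intro mult_right_mono mult_left_le) auto
    then show ?thesis using far[OF that, of k m] by linarith
  qed
  have conv: "convergent (\<lambda>k. s k i)" if "i < n" for i
  proof -
    have "summable (\<lambda>k. s (Suc k) i - s k i)"
    proof (rule summable_comparison_test')
      show "summable (\<lambda>k. (1 - q) * r * q ^ k)"
        using q by (intro summable_mult summable_geometric) simp
      show "norm (s (Suc k) i - s k i) \<le> (1 - q) * r * q ^ k" if "k \<ge> 0" for k
        using step[of k] \<open>i < n\<close> by (simp add: mult_ac)
    qed
    then have "convergent (\<lambda>m. \<Sum>k<m. s (Suc k) i - s k i)"
      by (simp add: summable_iff_convergent)
    moreover have "(\<Sum>k<m. s (Suc k) i - s k i) = s m i" for m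
      by (induction m) (simp_all add: s0)
    ultimately show ?thesis by simp
  qed
  define y where "y i = lim (\<lambda>k. s k i)" for i
  have lim: "(\<lambda>k. s k i) \<longlonglongrightarrow> y i" if "i < n" for i
    using conv[OF that] by (simp add: y_def convergent_LIMSEQ_iff)
  have y_ball: "\<bar>y i\<bar> \<le> r" if "i < n" for i
    using tendsto_rabs[OF lim[OF that]] by (rule LIMSEQ_le_const2) (use in_ball that in auto)
  have y_near: "\<bar>y i - s k i\<bar> \<le> q ^ k * r" if "i < n" for i k
  proof (rule LIMSEQ_le_const2)
    show "(\<lambda>m. \<bar>s (m + k) i - s k i\<bar>) \<longlonglongrightarrow> \<bar>y i - s k i\<bar>"
      by (intro tendsto_intros LIMSEQ_ignore_initial_segment lim that)
    show "\<exists>N. \<forall>m\<ge>N. \<bar>s (m + k) i - s k i\<bar> \<le> q ^ k * r"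
      using far'[OF that, of k] by (simp add: add.commute)
  qed
  have "T y i = y i" if "i < n" for i
  proof -
    \<comment> \<open>Contracting the bound \<open>y_near\<close> shows that \<open>T\<close> is
      continuous along the iterates, so \<open>s (Suc k)\<close> tends to \<open>T y\<close> as well
      as to \<open>y\<close>.\<close>
    have near: "norm (s (Suc k) i - T y i) \<le> q * r * q ^ k" for k
    proof -
      have "\<bar>T (s k) i - T y i\<bar> \<le> q * (q ^ k * r)"
        by (rule contr) (use in_ball y_ball y_near that in \<open>auto simp: abs_minus_commute\<close>)
      then show ?thesis by (simp add: sS mult_ac)
    qed
    have "(\<lambda>k. q * r * q ^ k) \<longlonglongrightarrow> 0"
      using q by (intro tendsto_mult_right_zero LIMSEQ_power_zero) simp
    then have "(\<lambda>k. s (Suc k) i - T y i) \<longlonglongrightarrow> 0"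
      by (rule tendsto_0_le[where K = 1])
         (intro always_eventually allI, use near order_trans[OF _ abs_ge_self] in auto)
    then have "(\<lambda>k. s (Suc k) i) \<longlonglongrightarrow> T y i"
      by (simp add: LIM_zero_iff)
    then show ?thesis
      using LIMSEQ_Suc[OF lim[OF that]] LIMSEQ_unique by blast
  qed
  then show ?thesis using y_ball by blast
qed

section \<open>Newton-type existence for quadratic systems\<close>

definition quad_eval :: "(int \<times> nat \<times> nat) list \<Rightarrow> (nat \<Rightarrow> real) \<Rightarrow> real" where
  "quad_eval Q x = (\<Sum>(q, k, m)\<leftarrow>Q. of_int q * x k * x m)"

lemma abs_sum_list_le: "\<bar>\<Sum>z\<leftarrow>xs. f z\<bar> \<le> (\<Sum>z\<leftarrow>xs. \<bar>f z\<bar> :: real)"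
  by (induction xs) (auto intro: order_trans[OF abs_triangle_ineq])

text \<open>Solving for y in x = c + A y, rather than for x, makes a fixed point of y - F (c + A
  y) a zero of F without any appeal to the invertibility of A.\<close>
lemma quadratic_system_solvable:
  fixes e c :: "nat \<Rightarrow> real" and A :: "nat \<Rightarrow> nat \<Rightarrow> real" and Q :: "nat \<Rightarrow> (int \<times> nat \<times> nat) list"
  assumes idx: "\<And>j q k m. j < n \<Longrightarrow> (q, k, m) \<in> set (Q j) \<Longrightarrow> k < n \<and> m < n"
    and S: "\<And>k. k < n \<Longrightarrow> (\<Sum>l<n. \<bar>A k l\<bar>) \<le> S" "0 \<le> S" and r: "0 \<le> r"
    and residual: "\<And>j. j < n \<Longrightarrow> \<bar>e j + quad_eval (Q j) c\<bar> \<le> r / 2"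
    and jacobian: "\<And>j. j < n \<Longrightarrow>
        (\<Sum>l<n. \<bar>(if l = j then 1 else 0) - (\<Sum>(q, k, m)\<leftarrow>Q j. of_int q * (c k * A m l + c m * A k l))\<bar>)
          + 2 * r * S\<^sup>2 * (\<Sum>(q, k, m)\<leftarrow>Q j. of_int \<bar>q\<bar>) \<le> 1 / 2"
  shows "\<exists>x. (\<forall>j<n. e j + quad_eval (Q j) x = 0) \<and> (\<forall>k<n. \<bar>x k - c k\<bar> \<le> S * r)"
proof -
  define h where "h y k = (\<Sum>l<n. A k l * y l)" for y k
  define X where "X y k = c k + h y k" for y k
  define T where "T y j = y j - (e j + quad_eval (Q j) (X y))" for y j
  have h_diff: "h x k - h y k = h (\<lambda>l. x l - y l) k" for x y k
    by (simp add: h_def sum_subtractf algebra_simps)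
  have h_le: "\<bar>h y k\<bar> \<le> S * d" if "k < n" "\<And>i. i < n \<Longrightarrow> \<bar>y i\<bar> \<le> d" "0 \<le> d" for y k d
  proof -
    have "\<bar>h y k\<bar> \<le> (\<Sum>l<n. \<bar>A k l\<bar> * d)"
      unfolding h_def by (rule order_trans[OF sum_abs]) (auto simp: abs_mult intro!: sum_mono mult_left_mono that)
    also have "\<dots> \<le> S * d"
      using S(1)[OF that(1)] that(3) by (simp add: sum_distrib_right[symmetric] mult_right_mono)
    finally show ?thesis .
  qed
  have "\<exists>y. \<forall>i<n. \<bar>y i\<bar> \<le> r \<and> T y i = y i"
  proof (rule contraction_fixpoint_coordinates[where q = "1/2"])
    fix x y :: "nat \<Rightarrow> real" and d j
    assume x: "\<And>i. i < n \<Longrightarrow> \<bar>x i\<bar> \<le> r" and y: "\<And>i. i < n \<Longrightarrow> \<bar>y i\<bar> \<le> r"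
      and d: "\<And>i. i < n \<Longrightarrow> \<bar>x i - y i\<bar> \<le> d" and j: "j < n"
    have d0: "0 \<le> d" using d[OF j] by linarith
    define z where "z l = x l - y l" for l
    \<comment> \<open>\<open>P\<close> is row \<open>j\<close> of I - F'(c) A, and \<open>E\<close>
      collects the second order terms of the exact difference of quadratic values.\<close>
    define P where "P l = (if l = j then 1 else 0) - (\<Sum>(q, k, m)\<leftarrow>Q j. of_int q * (c k * A m l + c m * A k l))" for l
    define E where "E = (\<Sum>(q, k, m)\<leftarrow>Q j. of_int q * (h x k * h z m + h y m * h z k))"
    have lin: "(\<Sum>l<n. (\<Sum>(q, k, m)\<leftarrow>L. of_int q * (c k * A m l + c m * A k l)) * z l)
        = (\<Sum>(q, k, m)\<leftarrow>L. of_int q * (c k * h z m + c m * h z k))" for L :: "(int \<times> nat \<times> nat) list"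
      by (induction L) (auto simp: h_def sum.distrib sum_distrib_left algebra_simps)
    have quad: "quad_eval L (X x) - quad_eval L (X y) = (\<Sum>(q, k, m)\<leftarrow>L. of_int q * (c k * h z m + c m * h z k))
          + (\<Sum>(q, k, m)\<leftarrow>L. of_int q * (h x k * h z m + h y m * h z k))" for L
    proof (induction L)
      case (Cons t L)
      then show ?case
        by (cases t) (simp add: quad_eval_def X_def z_def h_diff[symmetric] algebra_simps)
    qed (simp add: quad_eval_def)
    have "(\<Sum>l<n. P l * z l) = z j - (\<Sum>(q, k, m)\<leftarrow>Q j. of_int q * (c k * h z m + c m * h z k))"
      using j by (simp add: P_def left_diff_distrib sum_subtractf lin if_distrib[of "\<lambda>a. a * _"] cong: if_cong)
    then have "T x j - T y j = (\<Sum>l<n. P l * z l) - E"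
      using quad[of "Q j"] by (simp add: T_def E_def z_def)
    moreover have "\<bar>\<Sum>l<n. P l * z l\<bar> \<le> (\<Sum>l<n. \<bar>P l\<bar>) * d"
      unfolding sum_distrib_right
      by (rule order_trans[OF sum_abs]) (auto simp: abs_mult z_def intro!: sum_mono mult_left_mono d)
    moreover have "\<bar>E\<bar> \<le> (\<Sum>(q, k, m)\<leftarrow>Q j. of_int \<bar>q\<bar>) * (2 * r * S\<^sup>2 * d)"
    proof -
      have "\<bar>of_int q * (h x k * h z m + h y m * h z k)\<bar> \<le> of_int \<bar>q\<bar> * (2 * r * S\<^sup>2 * d)"
        if "(q, k, m) \<in> set (Q j)" for q :: int and k m
      proof -
        have km: "k < n" "m < n" using idx[OF j that] by auto
        have "\<bar>h x k * h z m\<bar> \<le> (S * r) * (S * d)" "\<bar>h y m * h z k\<bar> \<le> (S * r) * (S * d)"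
          unfolding abs_mult using km x y d d0 r S(2)
          by (auto intro!: mult_mono h_le simp: z_def)
        then have "\<bar>h x k * h z m + h y m * h z k\<bar> \<le> 2 * r * S\<^sup>2 * d"
          by (simp add: power2_eq_square algebra_simps)
        then show ?thesis by (simp add: abs_mult mult_left_mono)
      qed
      then have "(\<Sum>t\<leftarrow>Q j. \<bar>case t of (q, k, m) \<Rightarrow> of_int q * (h x k * h z m + h y m * h z k)\<bar>)
          \<le> (\<Sum>t\<leftarrow>Q j. (case t of (q, k, m) \<Rightarrow> real_of_int \<bar>q\<bar>) * (2 * r * S\<^sup>2 * d))"
        by (intro sum_list_mono) (auto split: prod.splits)
      also have "\<dots> = (\<Sum>(q, k, m)\<leftarrow>Q j. of_int \<bar>q\<bar>) * (2 * r * S\<^sup>2 * d)"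
      proof -
        have "(\<Sum>t\<leftarrow>L. (case t of (q, k, m) \<Rightarrow> real_of_int \<bar>q\<bar>) * (2 * r * S\<^sup>2 * d))
          = (\<Sum>(q, k, m)\<leftarrow>L. of_int \<bar>q\<bar>) * (2 * r * S\<^sup>2 * d)" for L :: "(int \<times> nat \<times> nat) list"
          by (induction L) (auto simp: algebra_simps)
        then show ?thesis .
      qed
      finally show ?thesis
        unfolding E_def using abs_sum_list_le order_trans by blast
    qed
    ultimately have "\<bar>T x j - T y j\<bar> \<le> (\<Sum>l<n. \<bar>P l\<bar>) * d + (\<Sum>(q, k, m)\<leftarrow>Q j. of_int \<bar>q\<bar>) * (2 * r * S\<^sup>2 * d)"
      by linarith
    also have "\<dots> = ((\<Sum>l<n. \<bar>P l\<bar>) + 2 * r * S\<^sup>2 * (\<Sum>(q, k, m)\<leftarrow>Q j. of_int \<bar>q\<bar>)) * d"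
      by (simp add: algebra_simps)
    also have "\<dots> \<le> 1 / 2 * d"
      using jacobian[OF j] d0 unfolding P_def by (intro mult_right_mono)
    finally show "\<bar>T x j - T y j\<bar> \<le> 1 / 2 * d" .
  next
    fix j assume "j < n"
    have "X (\<lambda>_. 0) = c" by (simp add: X_def h_def fun_eq_iff)
    then have "\<bar>T (\<lambda>_. 0) j\<bar> = \<bar>e j + quad_eval (Q j) c\<bar>"
      by (simp only: T_def diff_0 abs_minus_cancel)
    then show "\<bar>T (\<lambda>_. 0) j\<bar> \<le> (1 - 1 / 2) * r"
      using residual[OF \<open>j < n\<close>] by simp
  qed (use r in auto)
  then obtain y where y: "\<And>i. i < n \<Longrightarrow> \<bar>y i\<bar> \<le> r" "\<And>i. i < n \<Longrightarrow> T y i = y i" by blast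
  have "\<bar>X y k - c k\<bar> \<le> S * r" if "k < n" for k
    using h_le[OF that y(1) r] by (simp add: X_def)
  moreover have "e j + quad_eval (Q j) (X y) = 0" if "j < n" for j
    using y(2)[OF that] by (simp add: T_def)
  ultimately show ?thesis by blast
qed

section \<open>Reduction to integer arithmetic\<close>

fun jac_row :: "int list \<Rightarrow> int list list \<Rightarrow> (int \<times> nat \<times> nat) list \<Rightarrow> int list \<Rightarrow> int list" where
  "jac_row C M [] v = v"
| "jac_row C M ((q, k, m) # Q) v =
     jac_row C M Q (map2 (-) v (map2 (\<lambda>a b. q * C ! k * a + q * C ! m * b) (M ! m) (M ! k)))"

text \<open>With \<open>C\<close> and \<open>M\<close> the approximate zero and inverse scaled by
  \<open>D\<close> and \<open>B\<close>, and \<open>v\<close> the unit row scaled by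
  \<open>D * B\<close>, the result is a row of I - F'(c) A scaled by \<open>D * B\<close>.\<close>

lemma jac_row_nth:
  assumes "length v = n" "\<And>k. k < n \<Longrightarrow> length (M ! k) = n"
    and "\<And>q k m. (q, k, m) \<in> set Q \<Longrightarrow> k < n \<and> m < n"
  shows "length (jac_row C M Q v) = n \<and>
    (\<forall>l<n. jac_row C M Q v ! l = v ! l - (\<Sum>(q, k, m)\<leftarrow>Q. q * (C ! k * M ! m ! l + C ! m * M ! k ! l)))"
  using assms(1,3)
proof (induction Q arbitrary: v)
  case (Cons t Q)
  obtain q k m where t: "t = (q, k, m)" by (cases t)
  define w where "w = map2 (-) v (map2 (\<lambda>a b. q * C ! k * a + q * C ! m * b) (M ! m) (M ! k))"
  have km: "length (M ! k) = n" "length (M ! m) = n"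
    using Cons.prems(2)[of q k m] assms(2) t by auto
  then have w: "w ! l = v ! l - q * (C ! k * M ! m ! l + C ! m * M ! k ! l)" if "l < n" for l
    using Cons.prems(1) that by (auto simp: w_def algebra_simps)
  have len: "length w = n" using km Cons.prems(1) by (simp add: w_def)
  have "k < n \<and> m < n" if "(q, k, m) \<in> set Q" for q k m
    using Cons.prems(2) that by auto
  then show ?case
    using Cons.IH[OF len] w by (simp add: t w_def[symmetric])
qed simp

text \<open>Clears denominators with \<open>r = 1 / R\<close> and \<open>S = s\<close>, so that
  evaluation decides every hypothesis. A coarsely rounded inverse suffices, because the contraction
  factor need only be 1 / 2.\<close>

lemma quadratic_system_solvable_int:
  fixes D B K R s :: int and C E :: "int list" and M :: "int list list"
    and Q :: "(int \<times> nat \<times> nat) list list"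
  assumes pos: "0 < D" "0 < B" "0 < K" "0 < R" "0 \<le> s"
    and idx: "\<And>j. j < n \<Longrightarrow> list_all (\<lambda>(q, k, m). k < n \<and> m < n) (Q ! j)"
    and rows: "\<And>k. k < n \<Longrightarrow> length (M ! k) = n \<and> sum_list (map abs (M ! k)) \<le> s * B"
    and residual: "\<And>j. j < n \<Longrightarrow>
        2 * R * \<bar>E ! j * D\<^sup>2 + K * (\<Sum>(q, k, m)\<leftarrow>Q ! j. q * C ! k * C ! m)\<bar> \<le> K * D\<^sup>2"
    and jacobian: "\<And>j. j < n \<Longrightarrow>
        2 * (R * sum_list (map abs (jac_row C M (Q ! j) (map (\<lambda>l. if l = j then D * B else 0) [0..<n])))
          + 2 * s\<^sup>2 * D * B * (\<Sum>(q, k, m)\<leftarrow>Q ! j. \<bar>q\<bar>)) \<le> R * D * B"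
  shows "\<exists>x. (\<forall>j<n. of_int (E ! j) / of_int K + quad_eval (Q ! j) x = 0) \<and>
    (\<forall>k<n. \<bar>x k - of_int (C ! k) / of_int D\<bar> \<le> of_int s / of_int R)"
proof -
  define c where "c k = (of_int (C ! k) / of_int D :: real)" for k
  define A where "A k l = (of_int (M ! k ! l) / of_int B :: real)" for k l
  have idx': "k < n \<and> m < n" if "j < n" "(q, k, m) \<in> set (Q ! j)" for j q k m
    using idx[OF that(1)] that(2) by (auto simp: list_all_iff)
  have "\<exists>x. (\<forall>j<n. of_int (E ! j) / of_int K + quad_eval (Q ! j) x = 0) \<and>
    (\<forall>k<n. \<bar>x k - c k\<bar> \<le> of_int s * (1 / of_int R))"
  proof (rule quadratic_system_solvable[where A = A])
    show "k < n \<and> m < n" if "j < n" "(q, k, m) \<in> set (Q ! j)" for j q k m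
      using idx' that .
    show "(\<Sum>l<n. \<bar>A k l\<bar>) \<le> real_of_int s" if "k < n" for k
    proof -
      have "sum_list (map abs (M ! k)) = (\<Sum>l<n. \<bar>M ! k ! l\<bar>)"
        using rows[OF that] by (simp add: sum_list_sum_nth atLeast0LessThan)
      then have "(\<Sum>l<n. \<bar>M ! k ! l\<bar>) \<le> s * B" using rows[OF that] by simp
      then have "real_of_int (\<Sum>l<n. \<bar>M ! k ! l\<bar>) \<le> of_int (s * B)" by (rule of_int_le_iff[THEN iffD2])
      then show ?thesis
        using pos by (simp add: A_def sum_divide_distrib[symmetric] divide_le_eq)
    qed
    show "\<bar>of_int (E ! j) / of_int K + quad_eval (Q ! j) c\<bar> \<le> 1 / of_int R / 2" if "j < n" for j
    proof -
      define V where "V = (\<Sum>(q, k, m)\<leftarrow>Q ! j. q * C ! k * C ! m)"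
      have "quad_eval L c = of_int (\<Sum>(q, k, m)\<leftarrow>L. q * C ! k * C ! m) / (of_int D)\<^sup>2" for L
        by (induction L) (auto simp: quad_eval_def c_def power2_eq_square add_divide_distrib)
      then have eq: "of_int (E ! j) / of_int K + quad_eval (Q ! j) c
          = of_int (E ! j * D\<^sup>2 + K * V) / of_int (K * D\<^sup>2)"
        using pos by (simp add: V_def field_simps)
      have le: "real_of_int (2 * R * \<bar>E ! j * D\<^sup>2 + K * V\<bar>) \<le> of_int (K * D\<^sup>2)"
        using residual[OF that] unfolding V_def by (rule of_int_le_iff[THEN iffD2])
      have KD: "0 < real_of_int (K * D\<^sup>2)" using pos by simp
      have "\<bar>real_of_int u / of_int z\<bar> \<le> 1 / of_int R / 2"
        if "real_of_int (2 * R * \<bar>u\<bar>) \<le> of_int z" "0 < real_of_int z" for u z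
        using that pos by (simp add: abs_divide field_simps)
      from this[OF le KD] show ?thesis unfolding eq .
    qed
    show "(\<Sum>l<n. \<bar>(if l = j then 1 else 0) - (\<Sum>(q, k, m)\<leftarrow>Q ! j. of_int q * (c k * A m l + c m * A k l))\<bar>)
          + 2 * (1 / of_int R) * (of_int s)\<^sup>2 * (\<Sum>(q, k, m)\<leftarrow>Q ! j. of_int \<bar>q\<bar>) \<le> 1 / 2" if "j < n" for j
    proof -
      define v where "v = map (\<lambda>l. if l = j then D * B else 0) [0..<n]"
      define W where "W = jac_row C M (Q ! j) v"
      define w where "w = (\<Sum>(q, k, m)\<leftarrow>Q ! j. \<bar>q\<bar>)"
      have W: "W ! l = v ! l - (\<Sum>(q, k, m)\<leftarrow>Q ! j. q * (C ! k * M ! m ! l + C ! m * M ! k ! l))" if "l < n" for l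
        using jac_row_nth[of v n M "Q ! j" C] idx'[OF \<open>j < n\<close>] rows that by (auto simp: W_def v_def)
      have len: "length W = n"
        using jac_row_nth[of v n M "Q ! j" C] idx'[OF \<open>j < n\<close>] rows by (auto simp: W_def v_def)
      have lin: "(\<Sum>(q, k, m)\<leftarrow>L. of_int q * (c k * A m l + c m * A k l))
          = of_int (\<Sum>(q, k, m)\<leftarrow>L. q * (C ! k * M ! m ! l + C ! m * M ! k ! l)) / of_int (D * B)"
        for L :: "(int \<times> nat \<times> nat) list" and l
        by (induction L) (auto simp: c_def A_def add_divide_distrib algebra_simps)
      have absq: "(\<Sum>(q, k, m)\<leftarrow>L. real_of_int \<bar>q\<bar>) = of_int (\<Sum>(q, k, m)\<leftarrow>L. \<bar>q\<bar>)"
        for L :: "(int \<times> nat \<times> nat) list"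
        by (induction L) auto
      have "(\<Sum>l<n. \<bar>(if l = j then 1 else 0) - (\<Sum>(q, k, m)\<leftarrow>Q ! j. of_int q * (c k * A m l + c m * A k l))\<bar>)
          = (\<Sum>l<n. of_int \<bar>W ! l\<bar> / of_int (D * B))"
      proof (rule sum.cong)
        fix l assume "l \<in> {..<n}"
        then have l: "l < n" by simp
        have "(if l = j then 1 else 0) - of_int (\<Sum>(q, k, m)\<leftarrow>Q ! j. q * (C ! k * M ! m ! l + C ! m * M ! k ! l))
            / of_int (D * B) = (of_int (W ! l) / of_int (D * B) :: real)"
          using pos l W[OF l] by (simp add: v_def diff_divide_distrib)
        then show "\<bar>(if l = j then 1 else 0) - (\<Sum>(q, k, m)\<leftarrow>Q ! j. of_int q * (c k * A m l + c m * A k l))\<bar>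
            = real_of_int \<bar>W ! l\<bar> / of_int (D * B)"
          using pos by (simp only: lin) (simp add: abs_divide)
      qed simp
      also have "\<dots> = of_int (sum_list (map abs W)) / of_int (D * B)"
        using len by (simp add: sum_list_sum_nth atLeast0LessThan sum_divide_distrib[symmetric])
      finally have total: "(\<Sum>l<n. \<bar>(if l = j then 1 else 0)
            - (\<Sum>(q, k, m)\<leftarrow>Q ! j. of_int q * (c k * A m l + c m * A k l))\<bar>)
          = of_int (sum_list (map abs W)) / of_int (D * B)" .
      have "real_of_int (2 * (R * sum_list (map abs W) + 2 * s\<^sup>2 * D * B * w)) \<le> of_int (R * D * B)"
        using jacobian[OF that] unfolding W_def v_def w_def by (rule of_int_le_iff[THEN iffD2])
      then show ?thesis
        unfolding total absq w_def[symmetric] using pos by (simp add: field_simps)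
    qed
  qed (use pos in auto)
  then show ?thesis by (simp add: c_def)
qed

section \<open>The numerical system\<close>

text \<open>An unknown \<open>x\<close> with 31 coordinates describes four vectors
  \<open>y 0, \<dots>, y 3\<close> of \<open>c4\<close> as follows: \<open>x 0 = 1\<close>
  homogenises the linear terms; \<open>y 0 = (x 1, 0, 0, \<i> * x 2)\<close>; the coordinates
  \<open>8 * i - 1, \<dots>, 8 * i + 2\<close> and \<open>8 * i + 3, \<dots>, 8 * i + 6\<close>
  are the real and the imaginary parts of \<open>y i\<close>, for \<open>i = 1, 2, 3\<close>. The
  moments are \<open>(0, 0, - 3 * x 3)\<close>, \<open>(x 5, 0, x 3)\<close>,
  \<open>(- x 5 / 2, x 6, x 3)\<close> and \<open>(- x 5 / 2, - x 6, x 3)\<close>, and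
  \<open>- x 4\<close> is the Hermitian product of \<open>y 0\<close> with each of the others.
  Equation \<open>j\<close> is \<open>quad_consts ! j / 3267 + \<Sum> q * x k * x m = 0\<close>,
  where \<open>(q, k, m)\<close> runs through \<open>quad_terms ! j\<close>. The list
  \<open>newton_point\<close> is a numerical solution in units of \<open>1 / 10 ^ 8\<close>, and
  \<open>newton_inverse\<close> the inverse of its Jacobian, rounded, in units of
  \<open>1 / 100\<close>.\<close>

definition newton_point :: "int list" where
  "newton_point =
    [100000000, 55569819, -15662968, 5802589, 9741061, 56853524, 49236596, -22994987, 4859538,
    -12957992, -24991205, 7044047, -48330014, 60592924, -19391031, -28788790, 4600093, 48081665,
    38367300, -10814248, 23691277, -29495320, -39946562, 2697102, 25143531, -13139039, -22456396,
    6329584, 30830458, -17922638, 71760577]"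

definition newton_inverse :: "int list list" where
  "newton_inverse =
    [[50, 0, 0, 0, 0, 0, 0, 0, 0, 0, 0, 0, 0, 0, 0, 0, 0, 0, 0, 0, 0, 0, 0, 0, 0, 0, 0, 0, 0, 0,
     0],
     [-2, 98, 28, -712, 0, 0, 0, 0, 0, 0, 0, 0, 0, 0, 0, 0, 0, 0, 0, 0, 0, 0, 0, 0, 0, 0, 0, 0,
     0, 0, 0],
     [-8, 28, 98, -2527, 0, 0, 0, 0, 0, 0, 0, 0, 0, 0, 0, 0, 0, 0, 0, 0, 0, 0, 0, 0, 0, 0, 0, 0,
     0, 0, 0],
     [0, 0, 0, 862, 0, 0, 0, 0, 0, 0, 0, 0, 0, 0, 0, 0, 0, 0, 0, 0, 0, 0, 0, 0, 0, 0, 0, 0, 0, 0,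
     0],
     [0, 0, 0, 0, 513, 0, 0, 0, 0, 0, 0, 0, 0, 0, 0, 0, 0, 0, 0, 0, 0, 0, 0, 0, 0, 0, 0, 0, 0, 0,
     0],
     [0, 0, 0, 0, 0, 88, 0, 0, 0, 0, 0, 0, 0, 0, 0, 0, 0, 0, 0, 0, 0, 0, 0, 0, 0, 0, 0, 0, 0, 0,
     0],
     [0, 0, 0, 0, 0, 0, 102, 0, 0, 0, 0, 0, 0, 0, 0, 0, 0, 0, 0, 0, 0, 0, 0, 0, 0, 0, 0, 0, 0, 0,
     0],
     [-10, 70, 72, -1725, -1144, 4, 21, -3, 6, 13, -5, 152, 14, -14, -2, 31, 21, 52, 62, 18, 3,
     11, 0, 19, -4, 9, -27, 21, 8, 16, -7],
     [-62, -142, -288, 7225, -298, -104, -206, 138, -170, -28, 24, -80, -173, 141, -12, -201,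
     -30, -92, -284, 38, -40, 2, -18, 231, -39, -17, 159, 100, -58, 148, 70],
     [75, 195, 421, -9710, 869, 82, 301, -154, 167, 90, 52, -32, 129, -206, 16, 303, 58, 168,
     442, -38, 58, 6, 25, -306, 51, 31, -241, -123, 87, -192, -103],
     [-32, -95, -127, 2800, 995, -106, -68, 68, -131, -30, -15, -110, -52, 47, 0, -84, -37, -96,
     -146, -20, -12, -17, -3, 12, -1, -18, 69, -14, -23, 2, 24],
     [13, 2, -12, 437, -280, 30, 19, -19, 37, 8, 4, 31, 194, -13, 0, 24, 10, 27, 41, 6, 3, 5, 1,
     -3, 0, 5, -20, 4, 7, 0, -7],
     [-19, 67, -32, 1126, -2964, 79, -82, -32, 60, -109, 18, 338, 21, 56, -11, -56, 27, 56, -39,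
     62, -18, 25, -12, 184, -32, 10, 40, 107, -17, 126, 27],
     [-10, 117, 94, -1930, -2395, 48, 16, 39, 48, -58, 10, 247, 35, -11, -7, 47, 51, 123, 116,
     56, 0, 30, -4, 97, -18, 22, -42, 76, 12, 72, -6],
     [8, 71, 94, -1945, -781, 14, 73, -11, 21, 48, -18, -97, 49, -50, -6, 111, 74, 183, 221, 62,
     10, 39, -1, 67, -13, 33, -95, 73, 30, 56, -26],
     [-19, 14, -5, -74, -577, -18, -30, 19, -33, -3, -1, -37, -22, 18, 1, -42, -20, 117, -84,
     -13, -14, -14, -4, 33, -5, -15, 18, -1, -25, 16, 27],
     [-19, 147, 117, -3318, -3016, 42, 30, 28, 93, 13, -47, 222, 96, 31, 22, 114, 14, 227, 175,
     135, 24, 85, -1, 138, -27, 233, -38, 157, 68, 118, -59],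
     [-35, -99, -235, 5174, -840, -18, -160, 66, -31, 0, -30, 36, 1, 174, 10, -142, -62, -42,
     -274, 47, -21, 16, -12, 169, -29, 102, 25, 91, -25, 113, 34],
     [-19, -184, -310, 7725, 783, -102, -78, 132, -244, -23, -2, -283, -163, 107, -30, -179, -3,
     -93, -214, -104, -98, -103, -30, 224, -33, -123, 133, -23, -184, 106, 194],
     [-1, 90, 160, -4060, -221, 29, 22, -37, 69, 6, 0, 80, 46, -30, 8, 50, 1, 26, 240, 29, 28,
     29, 8, -63, 9, 35, -38, 6, 52, -30, -55],
     [42, -65, 5, 43, 2366, -16, 102, -30, -77, -11, 43, -195, -82, -102, -40, 26, -26, -131, 9,
     -121, -18, -75, 2, -135, 26, -211, 30, -144, -56, -112, 48],
     [-19, -204, -386, 9414, 60, -74, -113, 163, -248, -22, -19, -245, -153, 82, -59, -199, -12,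
     -78, -292, -69, -105, -87, -36, 312, -48, -55, 140, 32, -188, 168, 203],
     [-9, -202, -319, 7492, 1229, -64, -105, 67, -118, -11, -3, -132, -78, 64, 3, -151, -69,
     -225, -299, -46, -48, -48, -15, 118, -18, -52, 65, -5, -89, 58, 94],
     [8, -32, -108, 2680, -851, 14, 12, -27, 35, 3, 5, 28, 20, -25, 4, 28, -8, -15, 26, 20, 15,
     16, -9, 153, 19, -3, -20, -13, 27, -50, -12],
     [50, 61, 106, -2780, -189, 82, 144, -101, 136, 11, 18, 118, 79, -79, 9, 102, 0, 12, 127,
     -19, 34, -40, -24, -93, 110, 3, -79, -40, 103, -112, -39],
     [-34, -91, -168, 3795, 122, -97, -69, 89, -123, -10, -15, -109, -72, 64, -6, -90, -12, -38,
     -125, 4, -7, -22, -36, 123, 14, -7, 71, 32, -93, 70, 32],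
     [69, 207, 345, -8343, -937, 206, 163, -256, 353, 29, 42, 313, 207, -183, 17, 257, 33, 105,
     358, 48, 102, 97, -10, -235, 172, 20, -203, -93, 267, -203, -91],
     [-16, -80, -140, 3454, 264, -58, -46, 72, -99, -8, -12, -88, -58, 52, -5, -72, -9, -30,
     -101, -14, -29, -27, 3, 66, 132, -6, 57, 26, -75, 57, 26],
     [-38, 73, 144, -2156, 58, -47, -65, 112, -133, -10, -25, -95, -71, 127, -28, -115, 78, 169,
     -55, 12, -51, -51, 128, -85, -132, 30, 79, 65, -101, 316, 62],
     [25, 105, 306, -7087, 1914, 23, 95, -62, 80, 6, 12, 65, 45, -55, 9, 62, -13, -24, 62, -57,
     45, -31, 96, -414, 27, -4, -46, -28, 60, -101, -27],
     [21, 30, 71, -2191, 257, 49, 43, -97, 124, 10, 19, 100, 70, -90, 15, 99, -28, -54, 92, 73,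
     54, 56, -32, -97, 69, -9, -73, -46, 94, -176, -44]]"

text \<open>The common denominator is 3267 = 27 * 121; for instance 2541 / 3267 = 7 / 9 and 1023 /
  3267 = 31 / 99.\<close>

definition quad_consts :: "int list" where
  "quad_consts =
    [-3267, -1089, 0, -11, -31, -1056, -792, -2541, 0, 0, 0, 0, 0, -2541, 0, 0, 0, 0, 0, -2541,
    0, 0, 0, 0, 0, 1023, 0, 1023, 0, 1023, 0]"

definition quad_terms :: "(int \<times> nat \<times> nat) list list" where
  "quad_terms =
    [[(1, 0, 0)],
     [(1, 1, 1), (1, 2, 2)],
     [(2, 1, 2), (3, 0, 3)],
     [(1, 3, 3)],
     [(1, 4, 4)],
     [(1, 5, 5)],
     [(1, 6, 6)],
     [(1, 7, 7), (1, 8, 8), (1, 9, 9), (1, 10, 10), (1, 11, 11), (1, 12, 12), (1, 13, 13), (1, 14, 14)],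
     [(2, 7, 12), (-2, 11, 8), (2, 9, 14), (-2, 10, 13), (-1, 0, 5)],
     [(2, 7, 13), (-2, 11, 9), (2, 10, 12), (-2, 8, 14)],
     [(2, 7, 14), (-2, 11, 10), (2, 8, 13), (-2, 9, 12), (-1, 0, 3)],
     [(1, 1, 7), (1, 2, 14), (1, 0, 4)],
     [(1, 1, 11), (-1, 2, 10)],
     [(1, 15, 15), (1, 16, 16), (1, 17, 17), (1, 18, 18), (1, 19, 19), (1, 20, 20), (1, 21, 21), (1, 22, 22)],
     [(4, 15, 20), (-4, 19, 16), (4, 17, 22), (-4, 18, 21), (1, 0, 5)],
     [(2, 15, 21), (-2, 19, 17), (2, 18, 20), (-2, 16, 22), (-1, 0, 6)],
     [(2, 15, 22), (-2, 19, 18), (2, 16, 21), (-2, 17, 20), (-1, 0, 3)],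
     [(1, 1, 15), (1, 2, 22), (1, 0, 4)],
     [(1, 1, 19), (-1, 2, 18)],
     [(1, 23, 23), (1, 24, 24), (1, 25, 25), (1, 26, 26), (1, 27, 27), (1, 28, 28), (1, 29, 29), (1, 30, 30)],
     [(4, 23, 28), (-4, 27, 24), (4, 25, 30), (-4, 26, 29), (1, 0, 5)],
     [(2, 23, 29), (-2, 27, 25), (2, 26, 28), (-2, 24, 30), (1, 0, 6)],
     [(2, 23, 30), (-2, 27, 26), (2, 24, 29), (-2, 25, 28), (-1, 0, 3)],
     [(1, 1, 23), (1, 2, 30), (1, 0, 4)],
     [(1, 1, 27), (-1, 2, 26)],
     [(1, 7, 15), (1, 8, 16), (1, 9, 17), (1, 10, 18), (1, 11, 19), (1, 12, 20), (1, 13, 21), (1, 14, 22)],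
     [(1, 7, 19), (1, 8, 20), (1, 9, 21), (1, 10, 22), (-1, 11, 15), (-1, 12, 16), (-1, 13, 17), (-1, 14, 18)],
     [(1, 7, 23), (1, 8, 24), (1, 9, 25), (1, 10, 26), (1, 11, 27), (1, 12, 28), (1, 13, 29), (1, 14, 30)],
     [(1, 7, 27), (1, 8, 28), (1, 9, 29), (1, 10, 30), (-1, 11, 23), (-1, 12, 24), (-1, 13, 25), (-1, 14, 26)],
     [(1, 15, 23), (1, 16, 24), (1, 17, 25), (1, 18, 26), (1, 19, 27), (1, 20, 28), (1, 21, 29), (1, 22, 30)],
     [(1, 15, 27), (1, 16, 28), (1, 17, 29), (1, 18, 30), (-1, 19, 23), (-1, 20, 24), (-1, 21, 25), (-1, 22, 26)]]"

text \<open>Row sums of the scaled inverse are at most 150, so a ball of radius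
  \<open>1 / 10 ^ 7\<close> in the preconditioned variable moves each coordinate by at most
  \<open>150 / 10 ^ 7\<close>.\<close>

lemma quad_system_solution:
  "\<exists>x. (\<forall>j<31. of_int (quad_consts ! j) / 3267 + quad_eval (quad_terms ! j) x = 0) \<and>
    (\<forall>k<31. \<bar>x k - of_int (newton_point ! k) / 10 ^ 8\<bar> \<le> 150 / 10 ^ 7)"
proof -
  let ?D = "10 ^ 8 :: int" and ?B = "100 :: int" and ?K = "3267 :: int" and ?R = "10 ^ 7 :: int"
    and ?s = "150 :: int" and ?Q = quad_terms and ?C = newton_point and ?M = newton_inverse
  have "list_all (\<lambda>j. list_all (\<lambda>(q, k, m). k < 31 \<and> m < 31) (?Q ! j)) [0..<31]"
    by code_simp
  moreover have "list_all (\<lambda>k. length (?M ! k) = 31 \<and> sum_list (map abs (?M ! k)) \<le> ?s * ?B) [0..<31]"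
    by code_simp
  moreover have "list_all (\<lambda>j. 2 * ?R * \<bar>quad_consts ! j * ?D\<^sup>2
      + ?K * (\<Sum>(q, k, m)\<leftarrow>?Q ! j. q * ?C ! k * ?C ! m)\<bar> \<le> ?K * ?D\<^sup>2) [0..<31]"
    by code_simp
  moreover have "list_all (\<lambda>j. 2 * (?R * sum_list (map abs (jac_row ?C ?M (?Q ! j)
        (map (\<lambda>l. if l = j then ?D * ?B else 0) [0..<31])))
      + 2 * ?s\<^sup>2 * ?D * ?B * (\<Sum>(q, k, m)\<leftarrow>?Q ! j. \<bar>q\<bar>)) \<le> ?R * ?D * ?B) [0..<31]"
    by code_simp
  ultimately have "\<exists>x. (\<forall>j<31. of_int (quad_consts ! j) / of_int ?K + quad_eval (?Q ! j) x = 0) \<and>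
      (\<forall>k<31. \<bar>x k - of_int (?C ! k) / of_int ?D\<bar> \<le> of_int ?s / of_int ?R)"
    by (intro quadratic_system_solvable_int[where B = ?B and M = ?M]) (simp_all add: list_all_iff)
  then show ?thesis by simp
qed

text \<open>Three moments form an equilateral triangle at height \<open>z\<close>, as
  \<open>q\<^sup>2 = 3 / 4 * p\<^sup>2\<close>; the fourth lies on its axis at
  \<open>- 3 * z\<close>, so that they sum to zero.\<close>

lemma orbit_representatives_exist:
  obtains y :: "nat \<Rightarrow> c4" and p q z g :: real
  where "q\<^sup>2 = 8 / 33" "p\<^sup>2 = 32 / 99" "z\<^sup>2 = 1 / 297" "g\<^sup>2 = 31 / 3267" "0 < g"
    "Re (herm (y 0) (y 0)) = 1 / 3" "Re (herm (y 1) (y 1)) = 7 / 9"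
    "Re (herm (y 2) (y 2)) = 7 / 9" "Re (herm (y 3) (y 3)) = 7 / 9"
    "moment (y 0) = (0, 0, - 3 * z)" "moment (y 1) = (p, 0, z)"
    "moment (y 2) = (- p / 2, q, z)" "moment (y 3) = (- p / 2, - q, z)"
    "herm (y 0) (y 1) = of_real (- g)" "herm (y 0) (y 2) = of_real (- g)" "herm (y 0) (y 3) = of_real (- g)"
    "herm (y 1) (y 2) = of_real (- 31 / 99)" "herm (y 1) (y 3) = of_real (- 31 / 99)"
    "herm (y 2) (y 3) = of_real (- 31 / 99)"
proof -
  obtain x where e: "\<And>j. j < 31 \<Longrightarrow> of_int (quad_consts ! j) / 3267 + quad_eval (quad_terms ! j) x = 0"
    and near: "\<And>k. k < 31 \<Longrightarrow> \<bar>x k - of_int (newton_point ! k) / 10 ^ 8\<bar> \<le> 150 / 10 ^ 7"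
    using quad_system_solution by blast
  \<comment> \<open>The equations fix \<open>x 0\<close> and \<open>x 4\<close> only up to sign;
    closeness to the numerical point makes both positive, and \<open>x 0 = 1\<close> undoes the
    homogenisation.\<close>
  have lower: "of_int (newton_point ! k) / 10 ^ 8 - 150 / 10 ^ 7 \<le> x k" if "k < 31" for k
    using near[OF that] by linarith
  note sys = quad_eval_def quad_terms_def quad_consts_def
  have "(x 0)\<^sup>2 = 1"
    using e[of 0] by (simp add: sys power2_eq_square)
  moreover have "0 < x 0"
    using lower[of 0] by (simp add: newton_point_def)
  moreover have "0 < x 4"
    using lower[of 4] by (simp add: newton_point_def)
  ultimately have x0: "x 0 = 1" by (auto simp: power2_eq_1_iff)
  \<comment> \<open>The form of \<open>y 0\<close> is a normalisation: a phase makes its real and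
    imaginary parts orthogonal, a common right unit factor makes the first one real, and the moment
    then puts the second along k.\<close>
  define y :: "nat \<Rightarrow> c4" where "y i = (if i = 0 then (Complex (x 1) 0, 0, 0, Complex 0 (x 2))
    else (Complex (x (8 * i - 1)) (x (8 * i + 3)), Complex (x (8 * i)) (x (8 * i + 4)),
          Complex (x (8 * i + 1)) (x (8 * i + 5)), Complex (x (8 * i + 2)) (x (8 * i + 6))))" for i
  note simps = y_def complex_eq_iff power2_eq_square algebra_simps
  show thesis
  proof (rule that[of "x 6" "x 5" "x 3" "x 4" y])
    show "(x 6)\<^sup>2 = 8 / 33" "(x 5)\<^sup>2 = 32 / 99" "(x 3)\<^sup>2 = 1 / 297" "(x 4)\<^sup>2 = 31 / 3267"
      using e[of 3] e[of 4] e[of 5] e[of 6] by (simp_all add: sys power2_eq_square)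
    show "0 < x 4" by fact
    show "Re (herm (y 0) (y 0)) = 1 / 3" using e[of 1] by (simp add: sys simps)
    show "Re (herm (y 1) (y 1)) = 7 / 9" using e[of 7] by (simp add: sys simps)
    show "Re (herm (y 2) (y 2)) = 7 / 9" using e[of 13] by (simp add: sys simps)
    show "Re (herm (y 3) (y 3)) = 7 / 9" using e[of 19] by (simp add: sys simps)
    show "moment (y 0) = (0, 0, - 3 * x 3)" using e[of 2] by (simp add: sys simps x0)
    show "moment (y 1) = (x 5, 0, x 3)"
      using e[of 8] e[of 9] e[of 10] by (simp add: sys simps x0)
    show "moment (y 2) = (- x 5 / 2, x 6, x 3)"
      using e[of 14] e[of 15] e[of 16] by (simp add: sys simps x0)
    show "moment (y 3) = (- x 5 / 2, - x 6, x 3)"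
      using e[of 20] e[of 21] e[of 22] by (simp add: sys simps x0)
    show "herm (y 0) (y 1) = of_real (- x 4)" using e[of 11] e[of 12] by (simp add: sys simps x0)
    show "herm (y 0) (y 2) = of_real (- x 4)" using e[of 17] e[of 18] by (simp add: sys simps x0)
    show "herm (y 0) (y 3) = of_real (- x 4)" using e[of 23] e[of 24] by (simp add: sys simps x0)
    show "herm (y 1) (y 2) = of_real (- 31 / 99)" using e[of 25] e[of 26] by (simp add: sys simps)
    show "herm (y 1) (y 3) = of_real (- 31 / 99)" using e[of 27] e[of 28] by (simp add: sys simps)
    show "herm (y 2) (y 3) = of_real (- 31 / 99)" using e[of 29] e[of 30] by (simp add: sys simps)
  qed
qed

section \<open>Matching the parameters\<close>

theorem theorem4p7:
  shows "(\<exists>v. tight_simplex 12 v) \<and> (\<exists>v. tight_simplex 12 v \<and> cyclic_symmetric 12 v)"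
proof -
  obtain y :: "nat \<Rightarrow> c4" and p q z g :: real where sq: "q\<^sup>2 = 8 / 33" "p\<^sup>2 = 32 / 99" "z\<^sup>2 = 1 / 297" "g\<^sup>2 = 31 / 3267" "0 < g"
    and n: "Re (herm (y 0) (y 0)) = 1 / 3" "Re (herm (y 1) (y 1)) = 7 / 9"
      "Re (herm (y 2) (y 2)) = 7 / 9" "Re (herm (y 3) (y 3)) = 7 / 9"
    and m: "moment (y 0) = (0, 0, - 3 * z)" "moment (y 1) = (p, 0, z)"
      "moment (y 2) = (- p / 2, q, z)" "moment (y 3) = (- p / 2, - q, z)"
    and h: "herm (y 0) (y 1) = of_real (- g)" "herm (y 0) (y 2) = of_real (- g)" "herm (y 0) (y 3) = of_real (- g)"
      "herm (y 1) (y 2) = of_real (- 31 / 99)" "herm (y 1) (y 3) = of_real (- 31 / 99)"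
      "herm (y 2) (y 3) = of_real (- 31 / 99)"
    by (rule orbit_representatives_exist)
  define a where "a i = (if i = 0 then sqrt (2 / 3) else sqrt (2 / 9))" for i :: nat
  have a2: "(a i)\<^sup>2 = (if i = 0 then 2 / 3 else 2 / 9)" for i by (simp add: a_def)
  have a_pos: "0 < a i" for i by (simp add: a_def)
  have lt4: "i = 0 \<or> i = 1 \<or> i = 2 \<or> i = 3" if "i < 4" for i :: nat using that by linarith
  note sq' = sq(1-3)[unfolded power2_eq_square]
  have D: "(cmod (sqform (y i)))\<^sup>2 = (if i = 0 then 8 / 99 else 248 / 891)" if "i < 4" for i
    unfolding norm_sqform_sq using lt4[OF that]
    by (auto simp: n m sq' power2_eq_square simp del: One_nat_def)
  \<comment> \<open>This determines \<open>g\<close>, and \<open>prod1\<close> the value 31 / 99, as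
    the product of the two moduli divided by four times the product of the scalars. Both sides are
    nonnegative, so squares are compared, with \<open>D\<close> supplying squared norm minus squared
    moment.\<close>
  have prod0: "4 * (a 0 * a j) * g = cmod (sqform (y 0)) * cmod (sqform (y j))" if "0 < j" "j < 4" for j
  proof (rule power2_eq_imp_eq)
    show "(4 * (a 0 * a j) * g)\<^sup>2 = (cmod (sqform (y 0)) * cmod (sqform (y j)))\<^sup>2"
      using that by (simp add: power_mult_distrib a2 D sq)
  qed (use a_pos sq in \<open>auto intro!: mult_nonneg_nonneg less_imp_le\<close>)
  have prod1: "4 * (a i * a j) * (31 / 99) = cmod (sqform (y i)) * cmod (sqform (y j))"
    if "0 < i" "i < 4" "0 < j" "j < 4" for i j
  proof (rule power2_eq_imp_eq)
    show "(4 * (a i * a j) * (31 / 99))\<^sup>2 = (cmod (sqform (y i)) * cmod (sqform (y j)))\<^sup>2"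
      using that by (simp only: power_mult_distrib a2 D) (simp add: power2_eq_square)
  qed (use a_pos in \<open>auto intro!: mult_nonneg_nonneg less_imp_le\<close>)
  have "\<exists>v. tight_simplex 12 v \<and> cyclic_symmetric 12 v"
  proof (rule tight_simplex_from_orbit_representatives)
    show "Re (herm (y i) (y i)) = 1 - (a i)\<^sup>2" if "i < 4" for i
      using lt4[OF that] by (auto simp: a2 n simp del: One_nat_def)
    show "dot3 (moment (y i)) (moment (y j)) =
        (if i = j then 16 / 33 else 0) - 3 * ((a i)\<^sup>2 - 1 / 3) * ((a j)\<^sup>2 - 1 / 3) - 4 / 33"
      if "i < 4" "j < 4" for i j
      using lt4[OF that(1)] lt4[OF that(2)] by (auto simp: a2 m sq' simp del: One_nat_def)
    show "4 * of_real (a i * a j) * herm (y i) (y j)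
        = - of_real (cmod (sqform (y i)) * cmod (sqform (y j)))" if "i < j" "j < 4" for i j
    proof (cases "i = 0")
      case True
      have "herm (y 0) (y j) = of_real (- g)" using lt4[OF that(2)] that h True by (auto simp del: One_nat_def)
      then have "4 * of_real (a 0 * a j) * herm (y 0) (y j) = - of_real (4 * (a 0 * a j) * g)" by simp
      then show ?thesis using prod0[of j] that True by simp
    next
      case False
      have "herm (y i) (y j) = of_real (- 31 / 99)" using lt4[OF that(2)] lt4[of i] that h False by (auto simp del: One_nat_def)
      then have "4 * of_real (a i * a j) * herm (y i) (y j) = - of_real (4 * (a i * a j) * (31 / 99))" by simp
      moreover have "0 < i" "i < 4" "0 < j" using that False by auto
      ultimately show ?thesis using prod1[of i j] that(2) by (simp only:)
    qed
  qed
  then show ?thesis by blast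
qed

end
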